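(* Let $H$ be a real Hilbert space and let $F=f+g$, where $f:H\to\mathbb{R}$ is convex and $L$-smooth ($L>0$), and $g:H\to\mathbb{R}\cup\{\infty\}$ is convex, proper and lower-semicontinuous. Assume that $\mathcal{S}=\operatorname{argmin}_{x\in H}F(x)$ is nonempty and let $F^*=\min_{x\in H}F(x)$. Let $s\in\left(0,\frac1L\right]$, $m\in(0,1]$, let $(t_k)_{k\ge 0}$ be defined by $t_0=1$ and $t_k=\frac{m+\sqrt{m^2+4t_{k-1}^2}}{2}$ for $k\ge 1$, and set $\lambda_{k+1}=\frac{t_k-1}{t_{k+1}}$ for $k\ge 0$. Let $\gamma_0=s$ and $\gamma_{k+1}=(1+\lambda_{k+1})s$ for $k\ge 0$. Let $y_0\in H$, $z_0=y_0-\gamma_0\nabla f(y_0)$, $x_0=\operatorname{prox}_{\gamma_0 g}(z_0)$, and let $(x_k)_{k\ge0}$, $(y_k)_{k\ge 0}$, $(z_k)_{k\ge 0}$ be generated, for $k\ge 0$, by $$\begin{aligned} y_{k+1} &= x_k-s\nabla f(x_k),\\ z_{k+1} &= y_{k+1}+\lambda_{k+1}(y_{k+1}-y_k)+\frac{\lambda_{k+1}s}{\gamma_k}(z_k-x_k),\\ x_{k+1} &= \operatorname{prox}_{\gamma_{k+1}g}(z_{k+1}).\end{aligned}$$ Then, for every $x^*\in\mathcal{S}$ and every $k\ge 0$, $$F(x_k)-F^*\le \frac{\|y_0-x^*\|^2}{2st_k^2}.$$ Moreover, every weak subsequential limit point of $(x_k)_{k\ge 0}$, as $k\to\infty$, minimizes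 $F$.
   Context: $L$-smooth means that $f$ is (Fréchet) differentiable with $L$-Lipschitz continuous gradient $\nabla f$. For $\gamma>0$, $\operatorname{prox}_{\gamma g}(z)=\operatorname{argmin}_{x\in H}\left\{\gamma g(x)+\frac12\|x-z\|^2\right\}$ for $z\in H$. *)

theory Defs
  imports "HOL-Analysis.Analysis"
begin

definition gradient :: "('a::real_inner \<Rightarrow> real) \<Rightarrow> 'a \<Rightarrow> 'a"
  where "gradient f x = (THE D. GDERIV f x :> D)"

(* In a Hilbert space the Riesz representation theorem makes
   gradient f x well-defined wherever f is Frechet differentiable. *)
definition L_smooth :: "real \<Rightarrow> ('a::{real_inner,complete_space} \<Rightarrow> real) \<Rightarrow> bool"
  where "L_smooth L f \<longleftrightarrow> f differentiable_on UNIV \<and> L-lipschitz_on UNIV (gradient f)"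

(* The convexity inequality below is meaningful only for functions that do not take
   the value -\<infinity>, as guaranteed by proper; note that 0 * \<infinity> = 0 in ereal. *)
definition proper :: "('a \<Rightarrow> ereal) \<Rightarrow> bool"
  where "proper g \<longleftrightarrow> (\<forall>x. g x \<noteq> -\<infinity>) \<and> (\<exists>x. g x \<noteq> \<infinity>)"

definition convex_ereal :: "('a::real_vector \<Rightarrow> ereal) \<Rightarrow> bool"
  where "convex_ereal g \<longleftrightarrow>
    (\<forall>x y. \<forall>u\<in>{0..1}.
       g ((1 - u) *\<^sub>R x + u *\<^sub>R y) \<le> ereal (1 - u) * g x + ereal u * g y)"

definition lower_semicontinuous :: "('a::topological_space \<Rightarrow> ereal) \<Rightarrow> bool"
  where "lower_semicontinuous g \<longleftrightarrow> (\<forall>x. g x \<le> Liminf (at x) g)"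

definition argmin_set :: "('a \<Rightarrow> ereal) \<Rightarrow> 'a set"
  where "argmin_set F = {x. is_arg_min F (\<lambda>_. True) x}"

(* For \<gamma> > 0 and g convex, proper and lower semicontinuous on a Hilbert space,
   the minimizer exists and is unique, so that the choice made by arg_min is immaterial. *)
definition prox :: "real \<Rightarrow> ('a::real_inner \<Rightarrow> ereal) \<Rightarrow> 'a \<Rightarrow> 'a"
  where "prox \<gamma> g z =
    arg_min (\<lambda>x. ereal \<gamma> * g x + ereal ((1/2) * (norm (x - z))\<^sup>2)) (\<lambda>_. True)"

definition weakly_converges_to :: "(nat \<Rightarrow> 'a::real_normed_vector) \<Rightarrow> 'a \<Rightarrow> bool"
  where "weakly_converges_to x p \<longleftrightarrow>
    (\<forall>\<phi> :: 'a \<Rightarrow> real. bounded_linear \<phi> \<longrightarrow> (\<lambda>k. \<phi> (x k)) \<longlonglongrightarrow> \<phi> p)"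

definition weak_subseq_limit :: "(nat \<Rightarrow> 'a::real_normed_vector) \<Rightarrow> 'a \<Rightarrow> bool"
  where "weak_subseq_limit x p \<longleftrightarrow>
    (\<exists>r :: nat \<Rightarrow> nat. strict_mono r \<and> weakly_converges_to (x \<circ> r) p)"

end

theory Submission
  imports Defs
begin

text \<open>
  Fix a minimizer \<open>p\<close> of \<open>F\<close> and let \<open>D\<close> be the gradient of \<open>f\<close> at \<open>p\<close>. Fermat's rule makes
  \<open>- D\<close> a subgradient of \<open>g\<close> at \<open>p\<close>, so moving the linear function \<open>\<langle>D, \<cdot>\<rangle>\<close> from \<open>f\<close> to \<open>g\<close>
  leaves \<open>F\<close> unchanged and turns \<open>p\<close> into a common minimizer of both summands. After a translation
  and a rescaling by \<open>s\<close> one may think of \<open>p = 0\<close>, \<open>s = 1\<close> and \<open>f, g \<ge> 0 = f 0 = g 0\<close>.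

  Write \<open>G\<^sub>k\<close> for the gradient of \<open>f\<close> at \<open>x\<^sub>k\<close>, and \<open>\<xi>\<^sub>k = (z\<^sub>k - x\<^sub>k) / \<gamma>\<^sub>k\<close>, which is a
  subgradient of \<open>g\<close> at \<open>x\<^sub>k\<close> by the definition of the proximal map. In terms of
  \<open>w\<^sub>k = y\<^sub>k - \<xi>\<^sub>k\<close> the algorithm becomes an ordinary inertial scheme,
  \<open>w\<^sub>k\<^sub>+\<^sub>1 = x\<^sub>k - (G\<^sub>k + \<xi>\<^sub>k\<^sub>+\<^sub>1)\<close> and \<open>x\<^sub>k\<^sub>+\<^sub>1 = w\<^sub>k\<^sub>+\<^sub>1 + \<lambda>\<^sub>k\<^sub>+\<^sub>1 (w\<^sub>k\<^sub>+\<^sub>1 - w\<^sub>k)\<close>: the choice of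
  \<open>\<gamma>\<^sub>k\<close> is exactly the one for which this happens. The combination
  \<open>u\<^sub>k = t\<^sub>k x\<^sub>k - (t\<^sub>k - 1) w\<^sub>k\<close> then moves by \<open>- t\<^sub>k (G\<^sub>k + \<xi>\<^sub>k\<^sub>+\<^sub>1)\<close> only, and the energy

    \<open>E\<^sub>k = t\<^sub>k\<^sup>2 f(x\<^sub>k) + (t\<^sub>k\<^sup>2 - t\<^sub>k + 1) g(x\<^sub>k) + (t\<^sub>k - 1) \<langle>\<xi>\<^sub>k, x\<^sub>k\<rangle>
         + \<parallel>u\<^sub>k - t\<^sub>k G\<^sub>k - (t\<^sub>k - 1) \<xi>\<^sub>k\<parallel>\<^sup>2 / 2\<close>

  does not increase (\<open>energy_step\<close>) and starts below \<open>\<parallel>y\<^sub>0\<parallel>\<^sup>2 / 2\<close> (\<open>energy_rate\<close>). Since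
  \<open>\<langle>\<xi>\<^sub>k, x\<^sub>k\<rangle> \<ge> g(x\<^sub>k)\<close>, it dominates \<open>t\<^sub>k\<^sup>2 F(x\<^sub>k)\<close>, which is the claimed rate.

  The rate forces \<open>F(x\<^sub>k)\<close> down to the minimum because \<open>t\<^sub>k\<close> tends to infinity, so that weak
  limit points are minimizers by weak lower semicontinuity of convex functions. For \<open>f\<close> this is
  the tangent inequality; for \<open>g\<close> it is obtained from the subgradients supplied by the proximal
  map (\<open>weakly_lower_semicontinuous\<close>). The existence statements for Hilbert spaces, namely Riesz
  representation for the gradient and existence of the proximal point, both come from the fact that
  a minimizing sequence of a strongly convex function is Cauchy (\<open>strongly_convex_has_minimizer\<close>).
\<close>

section \<open>Strongly convex minimization and Fermat's rule in Hilbert spaces\<close>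

text \<open>
  By the midpoint inequality two nearly optimal points are close to each other, so a minimizing
  sequence is Cauchy. The function is real-valued on a set \<open>C\<close>, which stands for the effective
  domain of an extended-valued function; the premise \<open>lsc\<close> then expresses lower semicontinuity of
  the extension by \<open>\<infinity>\<close>.
\<close>

lemma strongly_convex_has_minimizer:
  fixes \<phi> :: "'a::{real_inner,complete_space} \<Rightarrow> real"
  assumes ne: "C \<noteq> {}"
    and mid: "\<And>x y. x \<in> C \<Longrightarrow> y \<in> C \<Longrightarrow> (1/2) *\<^sub>R (x + y) \<in> C \<and>
               \<phi> ((1/2) *\<^sub>R (x + y)) \<le> (\<phi> x + \<phi> y) / 2 - c * (norm (x - y))\<^sup>2"
    and c: "c > 0"
    and lsc: "\<And>X l m. (\<And>n. X n \<in> C) \<Longrightarrow> X \<longlonglongrightarrow> l \<Longrightarrow> (\<lambda>n. \<phi> (X n)) \<longlonglongrightarrow> m \<Longrightarrow> l \<in> C \<and> \<phi> l \<le> m"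
    and bdd: "\<And>x. x \<in> C \<Longrightarrow> B \<le> \<phi> x"
  shows "\<exists>p\<in>C. \<forall>x\<in>C. \<phi> p \<le> \<phi> x"
proof -
  define m where "m = Inf (\<phi> ` C)"
  have bdd': "bdd_below (\<phi> ` C)" using bdd by (auto intro!: bdd_belowI2)
  have m_le: "m \<le> \<phi> x" if "x \<in> C" for x
    unfolding m_def using bdd' that by (intro cINF_lower)
  have "\<exists>x\<in>C. \<phi> x < m + inverse (real (Suc n))" for n
  proof -
    have "Inf (\<phi> ` C) < m + inverse (real (Suc n))" unfolding m_def by simp
    then show ?thesis using ne bdd' by (subst (asm) cINF_less_iff) auto
  qed
  then obtain X where XC: "X n \<in> C" and Xm: "\<phi> (X n) < m + inverse (real (Suc n))" for n by metis
  have near: "c * (norm (X i - X j))\<^sup>2 \<le> inverse (real (Suc n))" if "n \<le> i" "n \<le> j" for n i j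
  proof -
    have "m \<le> (\<phi> (X i) + \<phi> (X j)) / 2 - c * (norm (X i - X j))\<^sup>2"
      using m_le mid[OF XC[of i] XC[of j]] by fastforce
    moreover have "\<phi> (X k) < m + inverse (real (Suc n))" if "n \<le> k" for k
    proof -
      have "inverse (real (Suc k)) \<le> inverse (real (Suc n))"
        using that by (intro le_imp_inverse_le) auto
      then show ?thesis using Xm[of k] by (meson add_left_mono less_le_trans)
    qed
    note this[OF that(1)] this[OF that(2)]
    ultimately show ?thesis by argo
  qed
  have "Cauchy X"
  proof (rule metric_CauchyI)
    fix e :: real assume e: "e > 0"
    then obtain n where n: "inverse (real (Suc n)) < c * e\<^sup>2"
      using c reals_Archimedean[of "c * e\<^sup>2"] by auto
    have "dist (X i) (X j) < e" if "n \<le> i" "n \<le> j" for i j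
    proof -
      have "c * (norm (X i - X j))\<^sup>2 < c * e\<^sup>2" using near[OF that] n by linarith
      then have "(norm (X i - X j))\<^sup>2 < e\<^sup>2" using c by simp
      then show ?thesis using e by (simp add: dist_norm power2_less_imp_less)
    qed
    then show "\<exists>M. \<forall>i\<ge>M. \<forall>j\<ge>M. dist (X i) (X j) < e" by blast
  qed
  then obtain p where p: "X \<longlonglongrightarrow> p" using Cauchy_convergent convergent_def by blast
  have "(\<lambda>n. \<phi> (X n)) \<longlonglongrightarrow> m"
  proof (rule tendsto_sandwich[where f = "\<lambda>_. m"])
    show "(\<lambda>n. m + inverse (real (Suc n))) \<longlonglongrightarrow> m"
      using tendsto_add[OF tendsto_const LIMSEQ_inverse_real_of_nat, of m] by simp
  qed (use m_le XC Xm in \<open>auto intro!: always_eventually less_imp_le\<close>)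
  from lsc[OF XC p this] have "p \<in> C" "\<phi> p \<le> m" by auto
  with m_le show ?thesis by (auto intro!: bexI[of _ p] intro: order_trans)
qed

lemma norm_midpoint_diff:
  fixes x y z :: "'a::real_inner"
  shows "(norm ((1/2) *\<^sub>R (x + y) - z))\<^sup>2
       = ((norm (x - z))\<^sup>2 + (norm (y - z))\<^sup>2) / 2 - (norm (x - y))\<^sup>2 / 4"
  by (simp add: power2_norm_eq_inner inner_simps inner_commute field_simps)

lemma GDERIV_half_norm_squared:
  "GDERIV (\<lambda>x. (norm (x - z))\<^sup>2 / 2) x :> (x - z)"
  unfolding gderiv_def power2_norm_eq_inner
  by (auto intro!: derivative_eq_intros simp: inner_commute)

lemma GDERIV_along_line:
  assumes "GDERIV \<phi> (a + \<tau> *\<^sub>R h) :> D"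
  shows "((\<lambda>\<sigma>. \<phi> (a + \<sigma> *\<^sub>R h)) has_field_derivative inner D h) (at \<tau>)"
proof -
  have "((\<lambda>\<sigma>. a + \<sigma> *\<^sub>R h) has_derivative (\<lambda>\<sigma>. \<sigma> *\<^sub>R h)) (at \<tau>)"
    by (auto intro!: derivative_eq_intros)
  from has_derivative_compose[OF this assms[unfolded gderiv_def]]
  have "((\<lambda>\<sigma>. \<phi> (a + \<sigma> *\<^sub>R h)) has_derivative (\<lambda>\<sigma>. inner (\<sigma> *\<^sub>R h) D)) (at \<tau>)" .
  moreover have "(\<lambda>\<sigma>. inner (\<sigma> *\<^sub>R h) D) = (*) (inner D h)"
    by (auto simp: inner_commute)
  ultimately show ?thesis by (simp add: has_field_derivative_def)
qed

text \<open>
  Fermat's rule for a sum of a differentiable function and a convex one: along the segment from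
  \<open>p\<close> to \<open>u\<close>, convexity bounds the decrease of \<open>g\<close> by a linear function, while the difference
  quotients of \<open>\<phi>\<close> converge to its directional derivative. It serves for the minimizer of \<open>F\<close>, for
  the proximal map, for Riesz representation and for tangents of convex functions.
\<close>

lemma first_order_optimality:
  fixes \<phi> g :: "'a::real_inner \<Rightarrow> real"
  assumes g: "convex_on C g"
    and D: "GDERIV \<phi> p :> D"
    and p: "p \<in> C" and min: "\<And>u. u \<in> C \<Longrightarrow> \<phi> p + g p \<le> \<phi> u + g u"
    and u: "u \<in> C"
  shows "g p - inner D (u - p) \<le> g u"
proof -
  define \<psi> where "\<psi> = (\<lambda>\<tau>. \<phi> (p + \<tau> *\<^sub>R (u - p)))"
  have "(\<psi> has_field_derivative inner D (u - p)) (at 0)"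
    unfolding \<psi>_def using D by (intro GDERIV_along_line) simp
  then have "((\<lambda>\<tau>. (\<psi> \<tau> - \<psi> 0) / \<tau>) \<longlongrightarrow> inner D (u - p)) (at_right 0)"
    unfolding has_field_derivative_iff by (auto intro: tendsto_mono[OF at_le])
  moreover have "g p - g u \<le> (\<psi> \<tau> - \<psi> 0) / \<tau>" if "0 < \<tau>" "\<tau> < 1" for \<tau>
  proof -
    have eq: "p + \<tau> *\<^sub>R (u - p) = (1 - \<tau>) *\<^sub>R p + \<tau> *\<^sub>R u" by (simp add: algebra_simps)
    have "convex C" using g by (rule convex_on_imp_convex)
    then have "(1 - \<tau>) *\<^sub>R p + \<tau> *\<^sub>R u \<in> C"
      using p u that by (auto simp: convex_alt)
    then have "\<phi> p + g p \<le> \<psi> \<tau> + g ((1 - \<tau>) *\<^sub>R p + \<tau> *\<^sub>R u)"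
      unfolding \<psi>_def eq by (rule min)
    also have "g ((1 - \<tau>) *\<^sub>R p + \<tau> *\<^sub>R u) \<le> (1 - \<tau>) * g p + \<tau> * g u"
      using convex_onD[OF g] p u that by auto
    finally have "\<tau> * (g p - g u) \<le> \<psi> \<tau> - \<psi> 0" by (simp add: \<psi>_def algebra_simps)
    then show ?thesis using that by (simp add: pos_le_divide_eq mult.commute)
  qed
  then have "eventually (\<lambda>\<tau>. g p - g u \<le> (\<psi> \<tau> - \<psi> 0) / \<tau>) (at_right 0)"
    by (auto simp: eventually_at_right_field intro!: exI[of _ 1])
  ultimately have "g p - g u \<le> inner D (u - p)"
    by (intro tendsto_lowerbound) auto
  then show ?thesis by simp
qed

text \<open>
  The representing vector is the minimizer of \<open>\<parallel>x\<parallel>\<^sup>2 / 2 - \<phi> x\<close>.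
\<close>

lemma riesz_representation:
  fixes \<phi> :: "'a::{real_inner,complete_space} \<Rightarrow> real"
  assumes "bounded_linear \<phi>"
  obtains D where "\<phi> = inner D"
proof -
  interpret bounded_linear \<phi> by fact
  obtain K where K: "\<And>x. norm (\<phi> x) \<le> norm x * K" using bounded by blast
  define \<psi> where "\<psi> = (\<lambda>x. (norm (x - 0))\<^sup>2 / 2 - \<phi> x)"
  have "\<exists>p\<in>UNIV. \<forall>x\<in>UNIV. \<psi> p \<le> \<psi> x"
  proof (rule strongly_convex_has_minimizer[of UNIV \<psi> "1/8" "- K\<^sup>2 / 2"])
    show "(1/2) *\<^sub>R (x + y) \<in> UNIV \<and> \<psi> ((1/2) *\<^sub>R (x + y)) \<le> (\<psi> x + \<psi> y) / 2 - 1/8 * (norm (x - y))\<^sup>2"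
      for x y
      unfolding \<psi>_def norm_midpoint_diff scaleR add by (simp add: field_simps)
    show "l \<in> UNIV \<and> \<psi> l \<le> m" if "X \<longlonglongrightarrow> l" "(\<lambda>n. \<psi> (X n)) \<longlonglongrightarrow> m" for X l m
    proof -
      have "(\<lambda>n. \<psi> (X n)) \<longlonglongrightarrow> \<psi> l"
        unfolding \<psi>_def using that(1) by (intro tendsto_intros tendsto) auto
      then show ?thesis using that(2) LIMSEQ_unique by blast
    qed
    show "- K\<^sup>2 / 2 \<le> \<psi> x" for x
    proof -
      have "0 \<le> (norm x - K)\<^sup>2" by simp
      then show ?thesis using K[of x] by (simp add: \<psi>_def power2_eq_square algebra_simps)
    qed
  qed auto
  then obtain p where p: "\<And>x. \<psi> p \<le> \<psi> x" by auto
  have ge: "\<phi> u \<le> \<phi> p + inner p (u - p)" for u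
  proof -
    have "convex_on UNIV (\<lambda>x. - \<phi> x)"
      by (rule convex_onI) (auto simp: add scaleR)
    then have "- \<phi> p - inner (p - 0) (u - p) \<le> - \<phi> u"
      using p by (intro first_order_optimality[OF _ GDERIV_half_norm_squared]) (auto simp: \<psi>_def)
    then show ?thesis by simp
  qed
  have "\<phi> h = inner p h" for h
    using ge[of "p + h"] ge[of "p - h"] by (simp add: add diff)
  then show ?thesis by (intro that) auto
qed

section \<open>Convex functions with Lipschitz gradient\<close>

text \<open>
  Without Riesz representation a differentiable function on an inner product space need not have a
  gradient vector; completeness of the space enters here.
\<close>

lemma GDERIV_gradient:
  fixes f :: "'a::{real_inner,complete_space} \<Rightarrow> real"
  assumes "L_smooth L f"
  shows "GDERIV f x :> gradient f x"
proof -
  obtain f' where f': "(f has_derivative f') (at x)"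
    using assms by (auto simp: L_smooth_def differentiable_on_def differentiable_def)
  then obtain D where "f' = inner D"
    using riesz_representation has_derivative_bounded_linear by blast
  then have "f' = (\<lambda>h. inner h D)" by (auto simp: inner_commute)
  with f' have D: "GDERIV f x :> D" by (simp add: gderiv_def)
  show ?thesis unfolding gradient_def
  proof (rule theI)
    show "GDERIV f x :> D" by (rule D)
  next
    fix D' assume "GDERIV f x :> D'"
    with D have "(\<lambda>h. inner h D') = (\<lambda>h. inner h D)"
      unfolding gderiv_def by (rule has_derivative_unique[symmetric])
    then have "inner (D' - D) (D' - D) = 0"
      by (metis inner_diff_right right_minus_eq)
    then show "D' = D" by simp
  qed
qed

lemma convex_above_tangent:
  assumes "convex_on UNIV f" "L_smooth L f"
  shows "f a + inner (gradient f a) (b - a) \<le> f b"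
proof -
  \<comment> \<open>Every point minimizes the zero function, written as the sum of \<open>- f\<close> and \<open>f\<close>.\<close>
  have "GDERIV (\<lambda>x. - f x) a :> - gradient f a"
    using GDERIV_gradient[OF assms(2)] by (rule GDERIV_minus)
  from first_order_optimality[OF assms(1) this, of b] show ?thesis by simp
qed

lemma descent_lemma:
  assumes "L_smooth L f"
  shows "f (a + h) \<le> f a + inner (gradient f a) h + L / 2 * (norm h)\<^sup>2"
proof -
  define \<psi> where "\<psi> = (\<lambda>\<tau>. f (a + \<tau> *\<^sub>R h) - \<tau> * inner (gradient f a) h - L * \<tau>\<^sup>2 / 2 * (norm h)\<^sup>2)"
  have der: "(\<psi> has_field_derivative
      inner (gradient f (a + \<tau> *\<^sub>R h) - gradient f a) h - L * \<tau> * (norm h)\<^sup>2) (at \<tau>)" for \<tau>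
  proof -
    note [derivative_intros] = GDERIV_along_line[OF GDERIV_gradient[OF assms]]
    show ?thesis unfolding \<psi>_def
      by (rule derivative_eq_intros refl | simp add: inner_diff_left)+
  qed
  have "\<psi> 1 \<le> \<psi> 0"
  proof (rule DERIV_nonpos_imp_nonincreasing[of 0 1 \<psi>])
    fix \<tau> :: real assume \<tau>: "0 \<le> \<tau>" "\<tau> \<le> 1"
    have "inner (gradient f (a + \<tau> *\<^sub>R h) - gradient f a) h
        \<le> norm (gradient f (a + \<tau> *\<^sub>R h) - gradient f a) * norm h"
      by (rule norm_cauchy_schwarz)
    also have "norm (gradient f (a + \<tau> *\<^sub>R h) - gradient f a) \<le> L * norm (\<tau> *\<^sub>R h)"
      using assms lipschitz_on_normD[of L UNIV "gradient f" "a + \<tau> *\<^sub>R h" a]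
      by (simp add: L_smooth_def)
    finally have "inner (gradient f (a + \<tau> *\<^sub>R h) - gradient f a) h - L * \<tau> * (norm h)\<^sup>2 \<le> 0"
      using \<tau> by (simp add: mult_right_mono power2_eq_square mult.assoc)
    with der show "\<exists>y. (\<psi> has_real_derivative y) (at \<tau>) \<and> y \<le> 0" by blast
  qed simp
  then show ?thesis by (simp add: \<psi>_def)
qed

text \<open>
  The tangent plane at \<open>a\<close> bounds \<open>f\<close> from below at the point reached from \<open>b\<close> by a gradient step of
  length \<open>s\<close> for the convex function \<open>f - \<langle>gradient f a, \<cdot>\<rangle>\<close>; the descent lemma bounds how far this
  step can decrease it.
\<close>

lemma cocoercive_lower_bound:
  assumes f: "convex_on UNIV f" "L_smooth L f" and s: "0 < s" "s \<le> 1 / L" and L: "0 < L"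
  shows "f a + inner (gradient f a) (b - a) + s / 2 * (norm (gradient f b - gradient f a))\<^sup>2 \<le> f b"
proof -
  define d where "d = gradient f b - gradient f a"
  have "L * s \<le> 1" using s L by (simp add: pos_le_divide_eq mult.commute)
  then have Ls: "L / 2 * s\<^sup>2 * (norm d)\<^sup>2 \<le> s / 2 * (norm d)\<^sup>2"
    using mult_right_mono[of "L * s" 1 "s / 2"] s
    by (intro mult_right_mono) (auto simp: power2_eq_square)
  have "f a + inner (gradient f a) (b + - (s *\<^sub>R d) - a) \<le> f (b + - (s *\<^sub>R d))"
    by (rule convex_above_tangent[OF f])
  also have "\<dots> \<le> f b + inner (gradient f b) (- (s *\<^sub>R d)) + L / 2 * (norm (- (s *\<^sub>R d)))\<^sup>2"
    by (rule descent_lemma[OF f(2)])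
  also have "\<dots> \<le> f b - s * inner (gradient f b) d + s / 2 * (norm d)\<^sup>2"
    using Ls s by (simp add: power_mult_distrib mult.assoc)
  finally have "f a + inner (gradient f a) (b - a) + s * inner (gradient f b - gradient f a) d
      - s / 2 * (norm d)\<^sup>2 \<le> f b"
    by (simp add: inner_simps algebra_simps)
  then show ?thesis
    unfolding d_def[symmetric] power2_norm_eq_inner[symmetric] by simp
qed

section \<open>Proximal maps and weak lower semicontinuity\<close>

lemma proper_real:
  assumes "proper g" "g u \<noteq> \<infinity>"
  shows "ereal (real_of_ereal (g u)) = g u"
  using assms by (auto simp: proper_def intro: ereal_real')

lemma convex_on_effective_domain:
  assumes "convex_ereal g" "proper g"
  shows "convex_on {u. g u \<noteq> \<infinity>} (\<lambda>u. real_of_ereal (g u))"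
proof -
  have *: "g ((1 - c) *\<^sub>R u + c *\<^sub>R v)
      \<le> ereal ((1 - c) * real_of_ereal (g u) + c * real_of_ereal (g v))"
    if "g u \<noteq> \<infinity>" "g v \<noteq> \<infinity>" "0 \<le> c" "c \<le> 1" for u v c
  proof -
    have "g ((1 - c) *\<^sub>R u + c *\<^sub>R v) \<le> ereal (1 - c) * g u + ereal c * g v"
      using assms(1) that by (auto simp: convex_ereal_def)
    also have "\<dots> = ereal (1 - c) * ereal (real_of_ereal (g u)) + ereal c * ereal (real_of_ereal (g v))"
      using proper_real[OF assms(2)] that by simp
    finally show ?thesis by simp
  qed
  have C: "convex {u. g u \<noteq> \<infinity>}"
    unfolding convex_alt using * by fastforce
  show ?thesis
  proof (rule convex_onI[OF _ C])
    fix c :: real and u v assume c: "0 < c" "c < 1" and uv: "u \<in> {u. g u \<noteq> \<infinity>}" "v \<in> {u. g u \<noteq> \<infinity>}"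
    then have "(1 - c) *\<^sub>R u + c *\<^sub>R v \<in> {u. g u \<noteq> \<infinity>}"
      using C by (auto simp: convex_alt)
    then have "ereal (real_of_ereal (g ((1 - c) *\<^sub>R u + c *\<^sub>R v))) = g ((1 - c) *\<^sub>R u + c *\<^sub>R v)"
      using proper_real[OF assms(2)] by simp
    with *[of u v c] c uv
    show "real_of_ereal (g ((1 - c) *\<^sub>R u + c *\<^sub>R v))
        \<le> (1 - c) * real_of_ereal (g u) + c * real_of_ereal (g v)"
      by (metis (mono_tags, lifting) ereal_less_eq(3) less_eq_real_def mem_Collect_eq)
  qed
qed

lemma lower_semicontinuous_sequentially:
  fixes g :: "'a::metric_space \<Rightarrow> ereal"
  assumes g: "lower_semicontinuous g" and X: "X \<longlonglongrightarrow> l" and c: "c \<longlonglongrightarrow> m"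
    and le: "\<And>n. g (X n) \<le> ereal (c n)"
  shows "g l \<le> ereal m"
proof (rule ccontr)
  assume "\<not> g l \<le> ereal m"
  then obtain r where r: "ereal m < ereal r" "ereal r < g l"
    using ereal_dense2[of "ereal m" "g l"] by (auto simp: not_le)
  have "g l \<le> Liminf (at l) g" using g by (simp add: lower_semicontinuous_def)
  with r(2) have "ereal r < Liminf (at l) g" by (rule less_le_trans)
  then have "eventually (\<lambda>u. ereal r < g u) (at l)" by (rule less_LiminfD)
  with r(2) have "eventually (\<lambda>u. ereal r < g u) (nhds l)"
    by (auto simp: eventually_at_filter elim: eventually_mono)
  then have "eventually (\<lambda>n. ereal r < g (X n)) sequentially"
    using X by (auto simp: filterlim_iff)
  moreover have "eventually (\<lambda>n. c n < r) sequentially"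
    using c r(1) by (intro order_tendstoD) auto
  ultimately have "eventually (\<lambda>n. False) sequentially"
  proof eventually_elim
    case (elim n)
    then have "ereal r < ereal (c n)" using le[of n] less_le_trans by blast
    with elim show ?case by simp
  qed
  then show False by simp
qed

lemma arg_min_ereal:
  fixes \<Phi> :: "'a \<Rightarrow> ereal"
  assumes "\<And>u. \<Phi> p \<le> \<Phi> u"
  shows "\<Phi> (arg_min \<Phi> (\<lambda>_. True)) \<le> \<Phi> u"
proof -
  have "is_arg_min \<Phi> (\<lambda>_. True) p" using assms by (auto simp: is_arg_min_def not_less)
  then have "is_arg_min \<Phi> (\<lambda>_. True) (arg_min \<Phi> (\<lambda>_. True))"
    unfolding arg_min_def by (rule someI)
  then show ?thesis by (auto simp: is_arg_min_def not_less)
qed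

text \<open>
  An affine minorant makes the proximal objective bounded below, hence the minimizer exists and the
  choice in the definition of \<open>prox\<close> is a genuine minimizer; Fermat's rule at that point gives the
  subgradient.
\<close>

lemma prox_subgradient:
  fixes g :: "'a::{real_inner,complete_space} \<Rightarrow> ereal"
  assumes g: "convex_ereal g" "proper g" "lower_semicontinuous g"
    and minorant: "\<And>u. ereal (b + inner a u) \<le> g u"
    and \<gamma>: "\<gamma> > 0"
  shows "g (prox \<gamma> g z) \<noteq> \<infinity>" (is ?dom)
    and "g u \<noteq> \<infinity> \<Longrightarrow> real_of_ereal (g (prox \<gamma> g z))
           + inner ((1 / \<gamma>) *\<^sub>R (z - prox \<gamma> g z)) (u - prox \<gamma> g z) \<le> real_of_ereal (g u)"
proof -
  define C where "C = {u. g u \<noteq> \<infinity>}"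
  define gr where "gr = (\<lambda>u. real_of_ereal (g u))"
  have gr: "g u = ereal (gr u)" if "u \<in> C" for u
    using that proper_real[OF g(2)] by (simp add: C_def gr_def)
  have gr_convex: "convex_on C gr"
    using convex_on_effective_domain[OF g(1,2)] by (simp add: C_def gr_def[abs_def])
  define \<phi> where "\<phi> = (\<lambda>u. (norm (u - z))\<^sup>2 / 2 + \<gamma> * gr u)"
  define \<Phi> where "\<Phi> = (\<lambda>u. ereal \<gamma> * g u + ereal ((1/2) * (norm (u - z))\<^sup>2))"
  have \<Phi>: "\<Phi> u = (if u \<in> C then ereal (\<phi> u) else \<infinity>)" for u
  proof (cases "u \<in> C")
    case True
    then show ?thesis using gr[OF True] by (simp add: \<Phi>_def \<phi>_def)
  next
    case False
    then show ?thesis using \<gamma> by (simp add: \<Phi>_def C_def)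
  qed
  have "\<exists>p\<in>C. \<forall>u\<in>C. \<phi> p \<le> \<phi> u"
  proof (rule strongly_convex_has_minimizer[of C \<phi> "1/8"])
    show "C \<noteq> {}" using g(2) by (auto simp: proper_def C_def)
    show "(1/2) *\<^sub>R (x + y) \<in> C \<and> \<phi> ((1/2) *\<^sub>R (x + y)) \<le> (\<phi> x + \<phi> y) / 2 - 1/8 * (norm (x - y))\<^sup>2"
      if "x \<in> C" "y \<in> C" for x y
    proof -
      have eq: "(1/2) *\<^sub>R (x + y) = (1 - 1/2) *\<^sub>R x + (1/2) *\<^sub>R y" by (simp add: algebra_simps)
      have "gr ((1/2) *\<^sub>R (x + y)) \<le> (gr x + gr y) / 2"
        unfolding eq using convex_onD[OF gr_convex, of "1/2" x y] that by simp
      from mult_left_mono[OF this, of \<gamma>] \<gamma>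
      have "\<gamma> * gr ((1/2) *\<^sub>R (x + y)) \<le> \<gamma> * gr x / 2 + \<gamma> * gr y / 2"
        by (simp add: field_simps)
      moreover have "(1/2) *\<^sub>R (x + y) \<in> C"
        using convexD_alt[OF convex_on_imp_convex[OF gr_convex], of x y "1/2"] that
        unfolding eq by simp
      ultimately show ?thesis
        unfolding \<phi>_def norm_midpoint_diff using zero_le_power2[of "norm (x - y)"] by argo
    qed
    show "l \<in> C \<and> \<phi> l \<le> m"
      if X: "\<And>n. X n \<in> C" "X \<longlonglongrightarrow> l" "(\<lambda>n. \<phi> (X n)) \<longlonglongrightarrow> m" for X l m
    proof -
      have "(\<lambda>n. (\<phi> (X n) - (norm (X n - z))\<^sup>2 / 2) / \<gamma>) \<longlonglongrightarrow> (m - (norm (l - z))\<^sup>2 / 2) / \<gamma>"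
        using X \<gamma> by (intro tendsto_intros) auto
      then have gl: "g l \<le> ereal ((m - (norm (l - z))\<^sup>2 / 2) / \<gamma>)"
        by (rule lower_semicontinuous_sequentially[OF g(3) X(2)])
          (use gr X(1) \<gamma> in \<open>simp add: \<phi>_def\<close>)
      then have "l \<in> C" by (auto simp: C_def)
      with gl gr \<gamma> show ?thesis by (simp add: \<phi>_def field_simps)
    qed
    show "\<gamma> * (b + inner a z) - \<gamma>\<^sup>2 * (norm a)\<^sup>2 / 2 \<le> \<phi> u" if "u \<in> C" for u
    proof -
      have "\<gamma> * (b + inner a u) \<le> \<gamma> * gr u"
        using minorant[of u] gr[OF that] \<gamma> by simp
      moreover have "0 \<le> (norm (u - z + \<gamma> *\<^sub>R a))\<^sup>2" by simp
      then have "0 \<le> (norm (u - z))\<^sup>2 + 2 * \<gamma> * (inner a u - inner a z) + \<gamma>\<^sup>2 * (norm a)\<^sup>2"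
        by (simp add: power2_norm_eq_inner power2_eq_square[of \<gamma>] inner_simps inner_commute algebra_simps)
      ultimately show ?thesis by (simp add: \<phi>_def algebra_simps)
    qed
  qed simp
  then obtain p where p: "p \<in> C" "\<And>u. u \<in> C \<Longrightarrow> \<phi> p \<le> \<phi> u" by auto
  define q where "q = prox \<gamma> g z"
  have "\<Phi> p \<le> \<Phi> u" for u using p by (simp add: \<Phi>)
  then have q: "\<Phi> q \<le> \<Phi> u" for u
    unfolding q_def prox_def \<Phi>_def by (rule arg_min_ereal)
  have qC: "q \<in> C" using q[of p] p(1) by (auto simp: \<Phi> split: if_splits)
  then show ?dom by (simp add: C_def q_def)
  show "real_of_ereal (g (prox \<gamma> g z)) + inner ((1 / \<gamma>) *\<^sub>R (z - prox \<gamma> g z)) (u - prox \<gamma> g z)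
      \<le> real_of_ereal (g u)" if "g u \<noteq> \<infinity>"
  proof -
    have min: "\<phi> q \<le> \<phi> v" if "v \<in> C" for v using q[of v] qC that by (simp add: \<Phi>)
    have "convex_on C (\<lambda>u. \<gamma> * gr u)" using \<gamma> gr_convex by (intro convex_on_cmul) auto
    then have "\<gamma> * gr q - inner (q - z) (u - q) \<le> \<gamma> * gr u"
      by (rule first_order_optimality[OF _ GDERIV_half_norm_squared])
        (use qC min that in \<open>auto simp: \<phi>_def C_def\<close>)
    then have "\<gamma> * (gr q + inner ((1 / \<gamma>) *\<^sub>R (z - q)) (u - q)) \<le> \<gamma> * gr u"
      using \<gamma> by (simp add: algebra_simps inner_diff_left)
    then show ?thesis using \<gamma> by (simp add: gr_def q_def)
  qed
qed

text \<open>
  The subgradient of \<open>g\<close> at \<open>q\<^sub>\<gamma> = prox \<gamma> g p\<close> is an affine minorant, and affine functions are weakly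
  continuous; hence \<open>g q\<^sub>\<gamma> + \<parallel>p - q\<^sub>\<gamma>\<parallel>\<^sup>2 / \<gamma> \<le> m\<close>. As \<open>\<gamma>\<close> tends to zero this forces \<open>q\<^sub>\<gamma>\<close> to converge to \<open>p\<close>
  in norm, and strong lower semicontinuity applies.
\<close>

lemma weakly_lower_semicontinuous:
  fixes g :: "'a::{real_inner,complete_space} \<Rightarrow> ereal"
  assumes g: "convex_ereal g" "proper g" "lower_semicontinuous g"
    and minorant: "\<And>u. ereal (b + inner a u) \<le> g u"
    and X: "weakly_converges_to X p" and c: "c \<longlonglongrightarrow> m"
    and le: "\<And>n. g (X n) \<le> ereal (c n)"
  shows "g p \<le> ereal m"
proof -
  define \<gamma> where "\<gamma> = (\<lambda>k. inverse (real (Suc k)))"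
  have \<gamma>: "\<gamma> k > 0" for k by (simp add: \<gamma>_def)
  have \<gamma>0: "\<gamma> \<longlonglongrightarrow> 0" unfolding \<gamma>_def by (rule LIMSEQ_inverse_real_of_nat)
  define q where "q = (\<lambda>k. prox (\<gamma> k) g p)"
  define gr where "gr = (\<lambda>u. real_of_ereal (g u))"
  have q: "g (q k) = ereal (gr (q k))" for k
    using proper_real[OF g(2) prox_subgradient(1)[OF g minorant \<gamma>]] by (simp add: q_def gr_def)
  have bound: "gr (q k) + (norm (p - q k))\<^sup>2 / \<gamma> k \<le> m" for k
  proof -
    define \<xi> where "\<xi> = (1 / \<gamma> k) *\<^sub>R (p - q k)"
    have "gr (q k) + inner \<xi> (X n - q k) \<le> c n" for n
    proof -
      have "g (X n) \<noteq> \<infinity>" using le[of n] by auto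
      from prox_subgradient(2)[OF g minorant \<gamma> this] proper_real[OF g(2) this] le[of n]
      show ?thesis by (metis \<xi>_def ereal_less_eq(3) gr_def order_trans q_def)
    qed
    moreover have "(\<lambda>n. inner \<xi> (X n)) \<longlonglongrightarrow> inner \<xi> p"
      using X bounded_linear_inner_right by (auto simp: weakly_converges_to_def)
    then have "(\<lambda>n. gr (q k) + (inner \<xi> (X n) - inner \<xi> (q k))) \<longlonglongrightarrow> gr (q k) + (inner \<xi> p - inner \<xi> (q k))"
      by (intro tendsto_add tendsto_diff tendsto_const)
    ultimately have "gr (q k) + (inner \<xi> p - inner \<xi> (q k)) \<le> m"
      using c by (intro LIMSEQ_le[of _ _ c m]) (auto simp: inner_diff_right)
    then have "gr (q k) + inner \<xi> (p - q k) \<le> m" by (simp only: inner_diff_right)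
    then show ?thesis by (simp add: \<xi>_def power2_norm_eq_inner)
  qed
  have "q \<longlonglongrightarrow> p"
  proof -
    have "(norm (q k - p))\<^sup>2 \<le> 2 * \<gamma> k * (m - b - inner a p) + (\<gamma> k)\<^sup>2 * (norm a)\<^sup>2" for k
    proof -
      have "b + inner a (q k) \<le> gr (q k)" using minorant[of "q k"] by (simp add: q)
      with bound[of k] have "(norm (p - q k))\<^sup>2 / \<gamma> k \<le> m - b - inner a (q k)" by simp
      then have "(norm (p - q k))\<^sup>2 \<le> \<gamma> k * (m - b - inner a (q k))"
        using \<gamma>[of k] by (simp add: pos_divide_le_eq mult.commute)
      moreover have "0 \<le> (norm (p - q k - \<gamma> k *\<^sub>R a))\<^sup>2" by simp
      ultimately show ?thesis
        by (simp add: power2_norm_eq_inner power2_eq_square[of "\<gamma> k"] inner_simps inner_commute algebra_simps)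
    qed
    moreover have "(\<lambda>k. 2 * \<gamma> k * (m - b - inner a p) + (\<gamma> k)\<^sup>2 * (norm a)\<^sup>2)
        \<longlonglongrightarrow> 2 * 0 * (m - b - inner a p) + 0\<^sup>2 * (norm a)\<^sup>2"
      using \<gamma>0 by (intro tendsto_intros)
    ultimately have "(\<lambda>k. (norm (q k - p))\<^sup>2) \<longlonglongrightarrow> 0"
      by (intro tendsto_sandwich[of "\<lambda>_. 0" "\<lambda>k. (norm (q k - p))\<^sup>2" sequentially _ 0]) auto
    then have "(\<lambda>k. norm (q k - p)) \<longlonglongrightarrow> 0"
      using tendsto_real_sqrt by fastforce
    then show ?thesis by (rule LIM_zero_cancel[OF tendsto_norm_zero_cancel])
  qed
  moreover have "g (q k) \<le> ereal m" for k
  proof -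
    have "0 \<le> (norm (p - q k))\<^sup>2 / \<gamma> k" using \<gamma>[of k] by simp
    then show ?thesis using bound[of k] by (simp add: q)
  qed
  ultimately show ?thesis
    by (rule lower_semicontinuous_sequentially[OF g(3) _ tendsto_const])
qed

section \<open>The energy estimate\<close>

lemma quad_nonpos:
  fixes q G :: "'a::real_inner"
  assumes "\<bar>c\<bar> \<le> t"
  shows "0 \<le> (norm q)\<^sup>2 / 2 + c * inner G q + t\<^sup>2 * (norm G)\<^sup>2 / 2"
proof -
  have c2: "c\<^sup>2 \<le> t\<^sup>2"
    using assms power_mono[of "\<bar>c\<bar>" t 2] by simp
  have "0 \<le> (norm (q + c *\<^sub>R G))\<^sup>2" by simp
  also have "\<dots> = (norm q)\<^sup>2 + 2 * c * inner G q + c\<^sup>2 * (norm G)\<^sup>2"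
    by (simp add: power2_norm_eq_inner inner_add_left inner_add_right inner_commute
        power2_eq_square[of c] algebra_simps)
  also have "\<dots> \<le> (norm q)\<^sup>2 + 2 * c * inner G q + t\<^sup>2 * (norm G)\<^sup>2"
    using mult_right_mono[OF c2, of "(norm G)\<^sup>2"] by simp
  finally show ?thesis by simp
qed

text \<open>
  The weights of \<open>g\<close> and of \<open>\<langle>X, x\<rangle>\<close> add up to \<open>t\<^sup>2\<close>. Putting the part \<open>t - 1\<close> of the weight on the
  linearization compensates for the subgradients of \<open>g\<close> entering the scheme one step later than the
  gradients of \<open>f\<close>: \<open>w\<close> is updated with the gradient at the old and the subgradient at the new point.
\<close>

definition energy :: "real \<Rightarrow> real \<Rightarrow> real \<Rightarrow> 'a::real_inner \<Rightarrow> 'a \<Rightarrow> 'a \<Rightarrow> 'a \<Rightarrow> real"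
  where "energy t f g x w G X = t\<^sup>2 * f + (t\<^sup>2 - t + 1) * g + (t - 1) * inner X x
           + (norm (t *\<^sub>R x - (t - 1) *\<^sub>R w - t *\<^sub>R G - (t - 1) *\<^sub>R X))\<^sup>2 / 2"

text \<open>
  Primed variables belong to the old iterate, with parameter \<open>t\<close>, the others to the new one, with
  parameter \<open>T\<close>; the minimizer is the origin, and both functions are nonnegative and vanish there.

  The difference of the energies is bounded by adding up the following inequalities, where
  \<open>A = T\<^sup>2 - T\<close>: \<open>f1\<close> with weight \<open>A\<close>, \<open>f2\<close> with weight \<open>T\<close>, \<open>f3\<close> with weight \<open>t\<^sup>2 - A\<close>, \<open>g1\<close> with
  weight \<open>A + 1 - t\<close>, \<open>g2\<close> with weight \<open>t\<close>, \<open>g3\<close> with weight \<open>t\<^sup>2 - A\<close>, and the monotonicity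
  \<open>\<langle>X - X', x - x'\<rangle> \<ge> 0\<close> of the subdifferential with weight \<open>(t - 1) T\<close>. The weights of \<open>f2\<close> and
  \<open>g2\<close> are forced by cancelling the terms that are linear in the position, and the weight of the
  monotonicity by cancelling the terms containing the velocity \<open>e = x' - w'\<close>. What remains is minus a
  quadratic form in \<open>G'\<close> and \<open>q = (T + t - 1) X - (t - 1) X'\<close>, nonnegative because \<open>T - 1 \<le> t\<close>.
\<close>

lemma energy_step:
  fixes x x' w w' G G' X X' :: "'a::real_inner"
    and t T f f' g g' :: real
  assumes t: "1 \<le> t" "t \<le> T" "T - 1 \<le> t" "T\<^sup>2 - T \<le> t\<^sup>2"
    and w: "w = x' - (G' + X)"
    and x: "T *\<^sub>R (x - w) = (t - 1) *\<^sub>R (w - w')"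
    and f1: "f + inner G (x' - x) + (norm (G' - G))\<^sup>2 / 2 \<le> f'"
    and f2: "f + (norm G)\<^sup>2 / 2 \<le> inner G x"
    and f3: "(norm G')\<^sup>2 / 2 \<le> f'"
    and g1: "g + inner X (x' - x) \<le> g'"
    and g1': "g' + inner X' (x - x') \<le> g"
    and g2: "g \<le> inner X x"
    and g3: "0 \<le> g'"
  shows "energy T f g x w G X \<le> energy t f' g' x' w' G' X'"
proof -
  define h where "h = x - x'"
  define e where "e = x' - w'"
  define q where "q = (T + t - 1) *\<^sub>R X - (t - 1) *\<^sub>R X'"
  define Z where "Z = (T + t - 1) *\<^sub>R X + T *\<^sub>R G - (t - 1) *\<^sub>R X'"
  define W where "W = t *\<^sub>R x' - (t - 1) *\<^sub>R w' - t *\<^sub>R G' - (t - 1) *\<^sub>R X'"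
  define p where "p = t *\<^sub>R G' + (t - 1) *\<^sub>R X' - (t - 1) *\<^sub>R e"
  \<comment> \<open>All positions are measured from the vector \<open>W\<close> in the old energy, so that it drops out.\<close>
  have xW: "x' = W + p"
    by (simp add: W_def p_def e_def algebra_simps)
  have Th: "T *\<^sub>R h = (t - 1) *\<^sub>R e - (T + t - 1) *\<^sub>R (G' + X)"
  proof -
    have "T *\<^sub>R h = T *\<^sub>R (x - w) - T *\<^sub>R (G' + X)"
      by (simp add: h_def w algebra_simps)
    then show ?thesis unfolding x by (simp add: w e_def algebra_simps)
  qed
  have Thi: "T * inner v h = (t - 1) * inner v e - (T + t - 1) * (inner v G' + inner v X)" for v
    using arg_cong[OF Th, of "inner v"] by (simp add: inner_simps)
  have newW: "T *\<^sub>R x - (T - 1) *\<^sub>R w - T *\<^sub>R G - (T - 1) *\<^sub>R X = W - Z"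
  proof -
    have "T *\<^sub>R x - (T - 1) *\<^sub>R w = T *\<^sub>R (x - w) + w" by (simp add: algebra_simps)
    also have "\<dots> = t *\<^sub>R x' - (t - 1) *\<^sub>R w' - t *\<^sub>R (G' + X)"
      unfolding x by (simp add: w algebra_simps)
    finally have "T *\<^sub>R x - (T - 1) *\<^sub>R w = t *\<^sub>R x' - (t - 1) *\<^sub>R w' - t *\<^sub>R (G' + X)" .
    then show ?thesis by (simp add: W_def Z_def algebra_simps)
  qed
  define A where "A = T\<^sup>2 - T"
  have A0: "0 \<le> A" using t by (simp add: A_def power2_eq_square)
  have tA: "0 \<le> t\<^sup>2 - A" using t by (simp add: A_def)
  have A1: "0 \<le> A + 1 - t"
  proof -
    have "t * (t - 1) \<le> T * (T - 1)" using t by (intro mult_mono) auto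
    then have "(t - 1) * (t - 1) \<le> A + 1 - t" by (simp add: A_def power2_eq_square algebra_simps)
    then show ?thesis using zero_le_square[of "t - 1"] by linarith
  qed
  have x_h: "x = x' + h" by (simp add: h_def)
  have F: "T\<^sup>2 * f - t\<^sup>2 * f' \<le> A * (inner G h - (norm (G' - G))\<^sup>2 / 2)
      + T * (inner G x - (norm G)\<^sup>2 / 2) - (t\<^sup>2 - A) * ((norm G')\<^sup>2 / 2)"
  proof -
    have "A * (f + - inner G h + (norm (G' - G))\<^sup>2 / 2) \<le> A * f'"
      using f1 A0 by (intro mult_left_mono) (simp_all add: h_def inner_simps)
    moreover have "T * (f + (norm G)\<^sup>2 / 2) \<le> T * inner G x"
      using f2 t by (intro mult_left_mono) auto
    moreover have "(t\<^sup>2 - A) * ((norm G')\<^sup>2 / 2) \<le> (t\<^sup>2 - A) * f'"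
      using f3 tA by (intro mult_left_mono) auto
    ultimately show ?thesis by (simp add: A_def algebra_simps)
  qed
  have Gg: "(T\<^sup>2 - T + 1) * g - (t\<^sup>2 - t + 1) * g' \<le> (A + 1 - t) * inner X h + t * inner X x"
  proof -
    have "(A + 1 - t) * (g - inner X h) \<le> (A + 1 - t) * g'"
      using g1 A1 by (intro mult_left_mono) (simp_all add: h_def inner_simps)
    moreover have "t * g \<le> t * inner X x"
      using g2 t by (intro mult_left_mono) auto
    moreover have "0 \<le> (t\<^sup>2 - A) * g'"
      using g3 tA by simp
    ultimately show ?thesis by (simp add: A_def algebra_simps)
  qed
  have mono: "0 \<le> (t - 1) * (T * (inner X h - inner X' h))"
  proof -
    have "0 \<le> inner X h - inner X' h" using g1 g1' by (simp add: h_def inner_simps)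
    then show ?thesis using t by simp
  qed
  have WZ: "(norm (W - Z))\<^sup>2 / 2 - (norm W)\<^sup>2 / 2 = (norm Z)\<^sup>2 / 2 - inner Z W"
    by (simp add: power2_norm_eq_inner inner_simps inner_commute field_simps)
  have "energy T f g x w G X - energy t f' g' x' w' G' X'
     = (T\<^sup>2 * f - t\<^sup>2 * f') + ((T\<^sup>2 - T + 1) * g - (t\<^sup>2 - t + 1) * g')
       + (T - 1) * inner X x - (t - 1) * inner X' x' + ((norm (W - Z))\<^sup>2 / 2 - (norm W)\<^sup>2 / 2)"
    unfolding energy_def newW W_def[symmetric] by simp
  also have "\<dots> \<le> (A * (inner G h - (norm (G' - G))\<^sup>2 / 2)
      + T * (inner G x - (norm G)\<^sup>2 / 2) - (t\<^sup>2 - A) * ((norm G')\<^sup>2 / 2))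
     + ((A + 1 - t) * inner X h + t * inner X x) + (t - 1) * (T * (inner X h - inner X' h))
      + (T - 1) * inner X x - (t - 1) * inner X' x' + ((norm Z)\<^sup>2 / 2 - inner Z W)"
    using F Gg mono WZ by linarith
  also have "\<dots> = T * (T * inner G h) + T * (T * inner X h) + (t - 1) * (T * inner X h - T * inner X' h)
     + inner Z p + (norm Z)\<^sup>2 / 2
     - A * (norm (G' - G))\<^sup>2 / 2 - T * (norm G)\<^sup>2 / 2 - (t\<^sup>2 - A) * (norm G')\<^sup>2 / 2"
    unfolding x_h xW by (simp add: A_def Z_def inner_simps power2_eq_square algebra_simps)
  also have "\<dots> = - ((norm q)\<^sup>2 / 2 + (T - 1) * inner G' q + t\<^sup>2 * (norm G')\<^sup>2 / 2)"
    unfolding Thi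
    by (simp add: A_def Z_def q_def p_def inner_simps inner_commute power2_norm_eq_inner
        power2_eq_square[of t] power2_eq_square[of T] field_simps)
  also have "\<dots> \<le> 0"
    using quad_nonpos[of "T - 1" t q G'] t by simp
  finally show ?thesis by simp
qed

text \<open>
  The vectors \<open>y0\<close> and \<open>Gy\<close> are the starting point and the gradient there. Because \<open>t 0 = 1\<close>, the
  initial energy is \<open>f 0 + g 0 + \<parallel>x 0 - G 0\<parallel>\<^sup>2 / 2\<close>, which a single proximal gradient step from \<open>y0\<close>
  brings below \<open>\<parallel>y0\<parallel>\<^sup>2 / 2\<close>.
\<close>

lemma energy_rate:
  fixes x w G X :: "nat \<Rightarrow> 'a::real_inner" and y0 Gy :: 'a and t f g :: "nat \<Rightarrow> real"
  assumes t0: "t 0 = 1"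
    and t: "\<And>k. t k \<le> t (Suc k)" "\<And>k. t (Suc k) - 1 \<le> t k" "\<And>k. (t (Suc k))\<^sup>2 - t (Suc k) \<le> (t k)\<^sup>2"
    and x0: "x 0 = y0 - Gy - X 0"
    and w: "\<And>k. w (Suc k) = x k - (G k + X (Suc k))"
    and x: "\<And>k. t (Suc k) *\<^sub>R (x (Suc k) - w (Suc k)) = (t k - 1) *\<^sub>R (w (Suc k) - w k)"
    and f1: "\<And>i j. f i + inner (G i) (x j - x i) + (norm (G j - G i))\<^sup>2 / 2 \<le> f j"
    and f2: "\<And>i. f i + (norm (G i))\<^sup>2 / 2 \<le> inner (G i) (x i)"
    and f3: "\<And>i. (norm (G i))\<^sup>2 / 2 \<le> f i"
    and Gy: "(norm Gy)\<^sup>2 \<le> inner Gy y0"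
    and g1: "\<And>i j. g i + inner (X i) (x j - x i) \<le> g j"
    and g2: "\<And>i. g i \<le> inner (X i) (x i)"
    and g3: "\<And>i. 0 \<le> g i"
  shows "(t k)\<^sup>2 * (f k + g k) \<le> (norm y0)\<^sup>2 / 2"
proof -
  have t1: "1 \<le> t k" for k
    by (induction k) (use t0 t(1) in \<open>auto intro: order_trans\<close>)
  define E where "E k = energy (t k) (f k) (g k) (x k) (w k) (G k) (X k)" for k
  have "E k \<le> E 0"
  proof (induction k)
    case (Suc k)
    have "E (Suc k) \<le> E k" unfolding E_def
      by (rule energy_step) (use t1 t w x f1 f2 f3 g1 g2 g3 in auto)
    with Suc show ?case by simp
  qed simp
  also have "E 0 \<le> (norm y0)\<^sup>2 / 2"
  proof -
    have "E 0 = f 0 + g 0 + (norm (x 0 - G 0))\<^sup>2 / 2" by (simp add: E_def energy_def t0)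
    also have "\<dots> \<le> (norm (x 0))\<^sup>2 / 2 + inner (X 0) (x 0)"
      using f2[of 0] g2[of 0]
      by (simp add: power2_norm_eq_inner inner_simps inner_commute field_simps)
    also have "\<dots> \<le> (norm y0)\<^sup>2 / 2"
    proof -
      have y0: "y0 = x 0 + X 0 + Gy" by (simp add: x0)
      have "0 \<le> (norm (X 0))\<^sup>2" "0 \<le> (norm Gy)\<^sup>2" by simp_all
      then show ?thesis using Gy unfolding y0
        by (simp add: power2_norm_eq_inner inner_simps inner_commute field_simps)
    qed
    finally show ?thesis .
  qed
  finally have "E k \<le> (norm y0)\<^sup>2 / 2" .
  moreover have "(t k)\<^sup>2 * (f k + g k) \<le> E k"
  proof -
    have "0 \<le> (t k - 1) * (inner (X k) (x k) - g k)" using t1[of k] g2[of k] by simp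
    then have "(t k)\<^sup>2 * (f k + g k)
        \<le> (t k)\<^sup>2 * f k + ((t k)\<^sup>2 - t k + 1) * g k + (t k - 1) * inner (X k) (x k)"
      by (simp add: algebra_simps)
    then show ?thesis unfolding E_def energy_def by (simp add: add_increasing2)
  qed
  ultimately show ?thesis by simp
qed

section \<open>Convergence of the algorithm\<close>

text \<open>
  This subgradient at a minimizer of the sum is also the source of the affine minorant of \<open>g\<close> that
  the existence of proximal points rests on.
\<close>

lemma minimizer_subgradient:
  fixes g :: "'a::{real_inner,complete_space} \<Rightarrow> ereal"
  assumes f: "L_smooth L f" and g: "convex_ereal g" "proper g"
    and p: "p \<in> argmin_set (\<lambda>u. ereal (f u) + g u)"
  shows "g p \<noteq> \<infinity>"
    and "g u \<noteq> \<infinity> \<Longrightarrow> real_of_ereal (g p) - inner (gradient f p) (u - p) \<le> real_of_ereal (g u)"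
proof -
  have min: "ereal (f p) + g p \<le> ereal (f u) + g u" for u
    using p by (auto simp: argmin_set_def is_arg_min_def not_less)
  obtain v where "g v \<noteq> \<infinity>" using g(2) by (auto simp: proper_def)
  with min[of v] show dom: "g p \<noteq> \<infinity>" by auto
  have "f p + real_of_ereal (g p) \<le> f u + real_of_ereal (g u)" if "g u \<noteq> \<infinity>" for u
    using min[of u] proper_real[OF g(2) dom] proper_real[OF g(2) that]
    by (metis ereal_less_eq(3) plus_ereal.simps(1))
  then show "real_of_ereal (g p) - inner (gradient f p) (u - p) \<le> real_of_ereal (g u)" if "g u \<noteq> \<infinity>"
    using that dom
    by (intro first_order_optimality[OF convex_on_effective_domain[OF g] GDERIV_gradient[OF f]]) auto
qed

text \<open>
  The recurrence is \<open>T\<^sup>2 - m T = t\<^sup>2\<close> for consecutive values, which gives the inequality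
  \<open>T\<^sup>2 - T \<le> t\<^sup>2\<close> of the energy estimate since \<open>m \<le> 1\<close>.
\<close>

lemma inertial_parameters:
  fixes t :: "nat \<Rightarrow> real"
  assumes m: "0 < m" "m \<le> 1" and t0: "t 0 = 1"
    and t: "\<And>k. t (Suc k) = (m + sqrt (m\<^sup>2 + 4 * (t k)\<^sup>2)) / 2"
  shows "1 \<le> t k" "t k + m / 2 \<le> t (Suc k)" "t (Suc k) - 1 \<le> t k" "(t (Suc k))\<^sup>2 - t (Suc k) \<le> (t k)\<^sup>2"
    and "filterlim t at_top sequentially"
proof -
  have step: "t k + m / 2 \<le> t (Suc k)" if "1 \<le> t k" for k
  proof -
    have "sqrt ((2 * t k)\<^sup>2) \<le> sqrt (m\<^sup>2 + 4 * (t k)\<^sup>2)" by (intro real_sqrt_le_mono) simp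
    then have "2 * t k \<le> sqrt (m\<^sup>2 + 4 * (t k)\<^sup>2)" using that by (simp only: real_sqrt_abs)
    then show ?thesis by (simp add: t)
  qed
  have t1: "1 \<le> t k" for k
  proof (induction k)
    case (Suc k)
    then show ?case using step[of k] m by linarith
  qed (simp add: t0)
  show "1 \<le> t k" by (rule t1)
  show "t k + m / 2 \<le> t (Suc k)" by (rule step[OF t1])
  have "sqrt (m\<^sup>2 + 4 * (t k)\<^sup>2) \<le> m + 2 * t k"
    using m t1[of k] by (intro real_le_lsqrt) (auto simp: power2_eq_square algebra_simps)
  then show "t (Suc k) - 1 \<le> t k" using m by (simp add: t field_simps)
  have "2 * t (Suc k) - m = sqrt (m\<^sup>2 + 4 * (t k)\<^sup>2)" by (simp add: t field_simps)
  then have "(2 * t (Suc k) - m)\<^sup>2 = m\<^sup>2 + 4 * (t k)\<^sup>2" by simp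
  then have "(t (Suc k))\<^sup>2 - m * t (Suc k) = (t k)\<^sup>2" by (simp add: power2_eq_square algebra_simps)
  moreover have "m * t (Suc k) \<le> 1 * t (Suc k)" using m t1[of "Suc k"] by (intro mult_right_mono) auto
  ultimately show "(t (Suc k))\<^sup>2 - t (Suc k) \<le> (t k)\<^sup>2" by simp
  have lin: "m / 2 * real k \<le> t k" for k
  proof (induction k)
    case (Suc k)
    then show ?case using step[OF t1[of k]] by (simp add: algebra_simps)
  qed (simp add: t0)
  have "filterlim (\<lambda>k. m / 2 * real k) at_top sequentially"
    using m by (intro filterlim_tendsto_pos_mult_at_top[OF tendsto_const _ filterlim_real_sequentially]) simp
  then show "filterlim t at_top sequentially"
    by (rule filterlim_at_top_mono) (use lin in auto)
qed

theorem theorem2: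
  fixes f :: "'a::{real_inner,complete_space} \<Rightarrow> real"
    and g F :: "'a \<Rightarrow> ereal"
    and L s m :: real
    and t lam gam :: "nat \<Rightarrow> real"
    and x y z :: "nat \<Rightarrow> 'a"
  assumes f_convex: "convex_on UNIV f"
    and L_pos: "L > 0"
    and f_smooth: "L_smooth L f"
    and g_convex: "convex_ereal g"
    and g_proper: "proper g"
    and g_lsc: "lower_semicontinuous g"
    and F_eq: "F = (\<lambda>u. ereal (f u) + g u)"
    and S_nonempty: "argmin_set F \<noteq> {}"
    and s_range: "s \<in> {0<..1 / L}"
    and m_range: "m \<in> {0<..1}"
    and t_0: "t 0 = 1"
    and t_Suc: "\<And>k. t (Suc k) = (m + sqrt (m\<^sup>2 + 4 * (t k)\<^sup>2)) / 2"
    and lam_Suc: "\<And>k. lam (Suc k) = (t k - 1) / t (Suc k)"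
    and gam_0: "gam 0 = s"
    and gam_Suc: "\<And>k. gam (Suc k) = (1 + lam (Suc k)) * s"
    and z_0: "z 0 = y 0 - gam 0 *\<^sub>R gradient f (y 0)"
    and x_0: "x 0 = prox (gam 0) g (z 0)"
    and y_Suc: "\<And>k. y (Suc k) = x k - s *\<^sub>R gradient f (x k)"
    and z_Suc: "\<And>k. z (Suc k) = y (Suc k) + lam (Suc k) *\<^sub>R (y (Suc k) - y k)
                      + (lam (Suc k) * s / gam k) *\<^sub>R (z k - x k)"
    and x_Suc: "\<And>k. x (Suc k) = prox (gam (Suc k)) g (z (Suc k))"
  shows "(\<forall>xstar \<in> argmin_set F. \<forall>k.
            F (x k) - (INF u. F u) \<le> ereal ((norm (y 0 - xstar))\<^sup>2 / (2 * s * (t k)\<^sup>2)))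
       \<and> (\<forall>p. weak_subseq_limit x p \<longrightarrow> p \<in> argmin_set F)"
proof -
  define gr where "gr = (\<lambda>u. real_of_ereal (g u))"
  have s: "0 < s" "s \<le> 1 / L" using s_range by auto
  have m: "0 < m" "m \<le> 1" using m_range by auto
  note t = inertial_parameters[OF m t_0 t_Suc]
  have lam: "0 \<le> lam (Suc k)" for k
    using t(1)[of k] t(1)[of "Suc k"] by (simp add: lam_Suc)
  have gam: "0 < gam k" for k
    using s lam by (cases k) (auto simp: gam_0 gam_Suc add_pos_nonneg)
  have x: "x k = prox (gam k) g (z k)" for k
    by (cases k) (auto simp: x_0 x_Suc)
  define \<xi> where "\<xi> k = (1 / gam k) *\<^sub>R (z k - x k)" for k
  have z: "z k = x k + gam k *\<^sub>R \<xi> k" for k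
    using gam[of k] by (simp add: \<xi>_def)
  have minorant: "ereal (gr p + inner (gradient f p) p + inner (- gradient f p) u) \<le> g u"
    if p: "p \<in> argmin_set F" for p u
  proof (cases "g u = \<infinity>")
    case False
    have "gr p - inner (gradient f p) (u - p) \<le> gr u"
      unfolding gr_def using minimizer_subgradient(2)[OF f_smooth g_convex g_proper p[unfolded F_eq] False] .
    moreover have "g u = ereal (gr u)" using proper_real[OF g_proper False] by (simp add: gr_def)
    ultimately show ?thesis by (simp add: inner_diff_right)
  qed simp
  obtain xs where xs: "xs \<in> argmin_set F" using S_nonempty by auto
  note prox = prox_subgradient[OF g_convex g_proper g_lsc minorant[OF xs] gam]
  have xdom: "g (x k) \<noteq> \<infinity>" for k
    using prox(1)[of k "z k"] by (simp add: x[symmetric])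
  have sub: "gr (x k) + inner (\<xi> k) (u - x k) \<le> gr u" if "g u \<noteq> \<infinity>" for k u
    using prox(2)[of u k "z k"] that by (simp add: x[symmetric] \<xi>_def gr_def)
  have Fx: "F u = ereal (f u + gr u)" if "g u \<noteq> \<infinity>" for u
    using proper_real[OF g_proper that] by (simp add: F_eq gr_def flip: plus_ereal.simps(1))
  have rate: "f (x k) + gr (x k) - (f p + gr p) \<le> (norm (y 0 - p))\<^sup>2 / (2 * s * (t k)\<^sup>2)"
    if p: "p \<in> argmin_set F" for p k
  proof -
    define D where "D = gradient f p"
    have pdom: "g p \<noteq> \<infinity>"
      by (rule minimizer_subgradient(1)[OF f_smooth g_convex g_proper p[unfolded F_eq]])
    have fermat: "gr p - inner D (u - p) \<le> gr u" if "g u \<noteq> \<infinity>" for u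
      unfolding gr_def D_def
      by (rule minimizer_subgradient(2)[OF f_smooth g_convex g_proper p[unfolded F_eq] that])
    \<comment> \<open>The quadratic term of the cocoercivity inequality is expressed by the shifted and rescaled
      gradients, since these are the vectors \<open>G\<close> of the energy estimate.\<close>
    have coc: "s * (f a + inner (gradient f a) (b - a))
        + (norm (s *\<^sub>R (gradient f b - D) - s *\<^sub>R (gradient f a - D)))\<^sup>2 / 2 \<le> s * f b" for a b
    proof -
      have "s * (f a + inner (gradient f a) (b - a) + s / 2 * (norm (gradient f b - gradient f a))\<^sup>2) \<le> s * f b"
        using cocoercive_lower_bound[OF f_convex f_smooth s L_pos] s(1) by simp
      moreover have "s *\<^sub>R (gradient f b - D) - s *\<^sub>R (gradient f a - D) = s *\<^sub>R (gradient f b - gradient f a)"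
        by (simp add: algebra_simps)
      then have "(norm (s *\<^sub>R (gradient f b - D) - s *\<^sub>R (gradient f a - D)))\<^sup>2
          = s * (s * (norm (gradient f b - gradient f a))\<^sup>2)"
        by (simp add: power_mult_distrib power2_eq_square[of s])
      ultimately show ?thesis by (simp add: distrib_left)
    qed
    \<comment> \<open>The linear function \<open>inner D\<close> is subtracted from \<open>f\<close> and added to \<open>g\<close>.\<close>
    have "(t k)\<^sup>2 * (s * (f (x k) - f p - inner D (x k - p)) + s * (gr (x k) - gr p + inner D (x k - p)))
        \<le> (norm (y 0 - p))\<^sup>2 / 2"
    proof (rule energy_rate[where x = "\<lambda>k. x k - p" and w = "\<lambda>k. y k - s *\<^sub>R \<xi> k - p"
          and G = "\<lambda>k. s *\<^sub>R (gradient f (x k) - D)" and X = "\<lambda>k. s *\<^sub>R (\<xi> k + D)"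
          and Gy = "s *\<^sub>R (gradient f (y 0) - D)" and t = t])
      show "t k \<le> t (Suc k)" for k using t(2)[of k] m by simp
      show "x 0 - p = y 0 - p - s *\<^sub>R (gradient f (y 0) - D) - s *\<^sub>R (\<xi> 0 + D)"
        using z[of 0] by (simp add: z_0 gam_0 algebra_simps)
      show "y (Suc k) - s *\<^sub>R \<xi> (Suc k) - p
          = x k - p - (s *\<^sub>R (gradient f (x k) - D) + s *\<^sub>R (\<xi> (Suc k) + D))" for k
        by (simp add: y_Suc algebra_simps)
      show "t (Suc k) *\<^sub>R (x (Suc k) - p - (y (Suc k) - s *\<^sub>R \<xi> (Suc k) - p))
          = (t k - 1) *\<^sub>R (y (Suc k) - s *\<^sub>R \<xi> (Suc k) - p - (y k - s *\<^sub>R \<xi> k - p))" for k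
      proof -
        have tl: "t k - 1 = t (Suc k) * lam (Suc k)" using t(1)[of "Suc k"] by (simp add: lam_Suc)
        have "x (Suc k) = z (Suc k) - gam (Suc k) *\<^sub>R \<xi> (Suc k)" by (simp add: z)
        also have "z (Suc k) = y (Suc k) + lam (Suc k) *\<^sub>R (y (Suc k) - y k) + (lam (Suc k) * s) *\<^sub>R \<xi> k"
          unfolding z_Suc \<xi>_def by simp
        finally have "x (Suc k) - (y (Suc k) - s *\<^sub>R \<xi> (Suc k))
            = lam (Suc k) *\<^sub>R (y (Suc k) - s *\<^sub>R \<xi> (Suc k) - (y k - s *\<^sub>R \<xi> k))"
          by (simp add: gam_Suc algebra_simps)
        moreover have "a - p - (b - p) = a - b" for a b by simp
        ultimately show ?thesis unfolding tl by simp
      qed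
      show "s * (f (x i) - f p - inner D (x i - p))
          + inner (s *\<^sub>R (gradient f (x i) - D)) (x j - p - (x i - p))
          + (norm (s *\<^sub>R (gradient f (x j) - D) - s *\<^sub>R (gradient f (x i) - D)))\<^sup>2 / 2
          \<le> s * (f (x j) - f p - inner D (x j - p))" for i j
        using coc[of "x i" "x j"] by (simp add: inner_simps algebra_simps)
      show "s * (f (x i) - f p - inner D (x i - p)) + (norm (s *\<^sub>R (gradient f (x i) - D)))\<^sup>2 / 2
          \<le> inner (s *\<^sub>R (gradient f (x i) - D)) (x i - p)" for i
        using coc[of "x i" p]
        by (simp add: D_def[symmetric] inner_diff_left inner_diff_right distrib_left right_diff_distrib)
      show "(norm (s *\<^sub>R (gradient f (x i) - D)))\<^sup>2 / 2 \<le> s * (f (x i) - f p - inner D (x i - p))" for i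
        using coc[of p "x i"]
        by (simp add: D_def[symmetric] inner_diff_left inner_diff_right distrib_left right_diff_distrib)
      show "(norm (s *\<^sub>R (gradient f (y 0) - D)))\<^sup>2 \<le> inner (s *\<^sub>R (gradient f (y 0) - D)) (y 0 - p)"
        using coc[of "y 0" p] coc[of p "y 0"]
        by (simp add: D_def[symmetric] inner_diff_left inner_diff_right distrib_left right_diff_distrib)
      show "s * (gr (x i) - gr p + inner D (x i - p)) + inner (s *\<^sub>R (\<xi> i + D)) (x j - p - (x i - p))
          \<le> s * (gr (x j) - gr p + inner D (x j - p))" for i j
        using mult_left_mono[OF sub[OF xdom[of j], of i], of s] s(1)
        by (simp add: inner_simps algebra_simps)
      show "s * (gr (x i) - gr p + inner D (x i - p)) \<le> inner (s *\<^sub>R (\<xi> i + D)) (x i - p)" for i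
        using mult_left_mono[OF sub[OF pdom, of i], of s] s(1)
        by (simp add: inner_simps algebra_simps)
      show "0 \<le> s * (gr (x i) - gr p + inner D (x i - p))" for i
        using fermat[OF xdom[of i]] s(1) by simp
    qed (use t_0 t(3,4) in auto)
    then have "(2 * s * (t k)\<^sup>2) * (f (x k) + gr (x k) - (f p + gr p)) \<le> (norm (y 0 - p))\<^sup>2"
      by (simp add: algebra_simps)
    moreover have "0 < 2 * s * (t k)\<^sup>2" using s(1) t(1)[of k] by simp
    ultimately show ?thesis by (simp add: pos_le_divide_eq mult.commute)
  qed
  have inf: "(INF u. F u) = F p" if "p \<in> argmin_set F" for p
    using that by (intro antisym INF_lower INF_greatest) (auto simp: argmin_set_def is_arg_min_def not_less)
  have fin: "g p \<noteq> \<infinity>" if "p \<in> argmin_set F" for p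
    by (rule minimizer_subgradient(1)[OF f_smooth g_convex g_proper that[unfolded F_eq]])
  show ?thesis
  proof (intro conjI ballI allI impI)
    fix p k assume p: "p \<in> argmin_set F"
    show "F (x k) - (INF u. F u) \<le> ereal ((norm (y 0 - p))\<^sup>2 / (2 * s * (t k)\<^sup>2))"
      unfolding inf[OF p] Fx[OF fin[OF p]] Fx[OF xdom] using rate[OF p, of k] by simp
  next
    fix p assume "weak_subseq_limit x p"
    then obtain r where r: "strict_mono r" "weakly_converges_to (x \<circ> r) p"
      by (auto simp: weak_subseq_limit_def)
    define e where "e n = (norm (y 0 - xs))\<^sup>2 / (2 * s * (t (r n))\<^sup>2)" for n
    \<comment> \<open>Bounding \<open>f\<close> from below by its tangent at \<open>p\<close> turns the rate into an upper bound for \<open>g\<close> along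
      the subsequence.\<close>
    define c where "c n = f xs + gr xs + e n - (f p + (inner (gradient f p) (x (r n)) - inner (gradient f p) p))" for n
    have "filterlim (\<lambda>n. t (r n)) at_top sequentially"
      by (rule filterlim_compose[OF t(5) filterlim_subseq[OF r(1)]])
    then have "e \<longlonglongrightarrow> 0" unfolding e_def using s(1)
      by (intro real_tendsto_divide_at_top[OF tendsto_const] filterlim_tendsto_pos_mult_at_top[OF tendsto_const]
          filterlim_pow_at_top) auto
    moreover have "(\<lambda>n. inner (gradient f p) (x (r n))) \<longlonglongrightarrow> inner (gradient f p) p"
      using r(2) bounded_linear_inner_right by (auto simp: weakly_converges_to_def o_def)
    ultimately have "c \<longlonglongrightarrow> f xs + gr xs + 0 - (f p + (inner (gradient f p) p - inner (gradient f p) p))"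
      unfolding c_def by (intro tendsto_add tendsto_diff tendsto_const)
    moreover have "g ((x \<circ> r) n) \<le> ereal (c n)" for n
    proof -
      have "gr (x (r n)) \<le> c n"
        using rate[OF xs, of "r n"] convex_above_tangent[OF f_convex f_smooth, of p "x (r n)"]
        by (simp add: c_def e_def inner_diff_right)
      then show ?thesis
        using proper_real[OF g_proper xdom[of "r n"]] by (metis comp_apply ereal_less_eq(3) gr_def)
    qed
    ultimately have "g p \<le> ereal (f xs + gr xs + 0 - (f p + (inner (gradient f p) p - inner (gradient f p) p)))"
      by (rule weakly_lower_semicontinuous[OF g_convex g_proper g_lsc minorant[OF xs] r(2)])
    then have le: "g p \<le> ereal (f xs + gr xs - f p)" by simp
    then have pdom: "g p \<noteq> \<infinity>" by auto
    have "F p \<le> F xs"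
      using le proper_real[OF g_proper pdom] unfolding Fx[OF pdom] Fx[OF fin[OF xs]]
      by (metis (no_types, lifting) add.commute ereal_less_eq(3) gr_def le_diff_eq)
    then show "p \<in> argmin_set F"
      using xs by (auto simp: argmin_set_def is_arg_min_def not_less intro: order_trans)
  qed
qed

end
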